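(* Let $H'=\langle E',Sp,Conn\rangle$ be an extended subhypergraph of some hypergraph $H$ and let $\mathcal{D}=\langle T,\chi,\lambda\rangle$ be a hypertree decomposition of $H'$. Then there exists a balanced separator in $\mathcal{D}$, i.e., there is a node $u$ of $T$ that is a balanced separator.
   Context: A (finite) hypergraph $H=(V(H),E(H))$ has a vertex set $V(H)$ and a set $E(H)\subseteq2^{V(H)}$ of non-empty edges, with no isolated vertices. For a set $S$ of sets, $\bigcup S$ denotes the union of its members. **Extended subhypergraph.** An extended subhypergraph of $H$ is a triple $\langle E',Sp,Conn\rangle$ with $E'\subseteq E(H)$, $Sp\subseteq2^{V(H)}$ (the "special edges"), and $Conn\subseteq V(H)$. **Tree notation.** For a (finite) rooted tree $T$ with node set $N(T)$ and $u\in N(T)$, $T_u$ is the subtree of $T$ rooted at $u$ (including $u$), and $T^{\uparrow}_u$ is the subtree of $T$ induced by $N(T)\setminus N(T_u)$. For a subtree $T'$, $\chi(T')=\bigcup_{u'\in T'}\chi(u')$. **Hypertree decomposition (HD) of an extended subhypergraph.** An HD of $H'=\langle E',Sp,Conn\rangle$ is a tuple $\langle T,\chi,\lambda\rangle$, where $T$ is a rooted tree and $\chi,\lambda$ label each node $u$ with a set $\chi(u)\subseteq V(H)$ and a set $\lambda(u)$ of (special) edges, such that: (1) for each $u\in N(T)$, either (a) $\lambda(u)\subseteq E(H)$ and $\chi(u)\subseteq\bigcup\lambda(u)$, or (b) $\lambda(u)=\{s\}$ for some $s\in Sp$ and $\chi(u)=s$; (2) each $f\in E'\cup Sp$ is covered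 by some $u\in N(T)$, i.e., (a) if $f\in E'$ then $f\subseteq\chi(u)$; (b) if $f\in Sp$ then $\lambda(u)=\{f\}$ and hence $\chi(u)=f$; (3) for each $v\in\bigcup E'\cup\bigcup Sp$, the set $\{u\in N(T)\mid v\in\chi(u)\}$ is connected in $T$; (4) for each $u\in N(T)$, $\chi(T_u)\cap\bigcup\lambda(u)\subseteq\chi(u)$; (5) if $\lambda(u)=\{s\}$ for some $s\in Sp$, then $u$ is a leaf of $T$; (6) the root $r$ of $T$ satisfies $Conn\subseteq\chi(r)$. **Edges covered for the first time.** For a node $u$ of $T$, $cov(u)=\{f\in E'\cup Sp\mid f\subseteq\chi(u)$ and $f\not\subseteq\chi(u')$ for all ancestors $u'$ of $u\}$ (proper ancestors). For a subtree $T'$ of $T$, $cov(T')=\bigcup_{u\in T'}cov(u)$. **Balanced separator.** A node $u$ of $T$ is a balanced separator if (i) for every subtree $T_{u_i}$ rooted at a child node $u_i$ of $u$, $|cov(T_{u_i})|\le\frac{|E'|+|Sp|}{2}$, and (ii) $|cov(T^{\uparrow}_u)|<\frac{|E'|+|Sp|}{2}$.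
   Formalization: It is additionally assumed that E' and Sp are not both empty; if both are empty, condition (ii) of a balanced separator reads 0 < 0, so no node of any decomposition is a balanced separator. *)

theory Defs
  imports Complex_Main
begin

record 'v hypergraph =
  hverts :: "'v set"
  hedges :: "'v set set"

definition is_hypergraph :: "'v hypergraph \<Rightarrow> bool" where
  "is_hypergraph H \<longleftrightarrow>
     finite (hverts H) \<and>
     hedges H \<subseteq> Pow (hverts H) \<and>
     {} \<notin> hedges H \<and>
     (\<forall>v\<in>hverts H. \<exists>e\<in>hedges H. v \<in> e)"

record 'v ext_subhypergraph =
  edges :: "'v set set"
  special :: "'v set set"
  conn :: "'v set"

definition is_ext_subhypergraph :: "'v hypergraph \<Rightarrow> 'v ext_subhypergraph \<Rightarrow> bool" where
  "is_ext_subhypergraph H H' \<longleftrightarrow>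
     edges H' \<subseteq> hedges H \<and>
     special H' \<subseteq> Pow (hverts H) \<and>
     conn H' \<subseteq> hverts H"

(* (u, w) \<in> children T means that w is a child of u.
   Acyclicity follows from the conditions in is_rooted_tree: every node is reachable
   from the root, the root has no parent, and parents are unique. *)
record 'n rooted_tree =
  nodes :: "'n set"
  root :: 'n
  children :: "('n \<times> 'n) set"

definition is_rooted_tree :: "'n rooted_tree \<Rightarrow> bool" where
  "is_rooted_tree T \<longleftrightarrow>
     finite (nodes T) \<and>
     root T \<in> nodes T \<and>
     children T \<subseteq> nodes T \<times> nodes T \<and>
     (\<forall>u. (u, root T) \<notin> children T) \<and>
     (\<forall>u u' w. (u, w) \<in> children T \<and> (u', w) \<in> children T \<longrightarrow> u = u') \<and>
     (\<forall>u\<in>nodes T. (root T, u) \<in> (children T)\<^sup>*)"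

definition leaf :: "'n rooted_tree \<Rightarrow> 'n \<Rightarrow> bool" where
  "leaf T u \<longleftrightarrow> u \<in> nodes T \<and> (\<forall>w. (u, w) \<notin> children T)"

definition proper_ancestor :: "'n rooted_tree \<Rightarrow> 'n \<Rightarrow> 'n \<Rightarrow> bool" where
  "proper_ancestor T a u \<longleftrightarrow> (a, u) \<in> (children T)\<^sup>+"

(* Subtrees are represented by their node sets; below is T_u, above its complement. *)
definition below :: "'n rooted_tree \<Rightarrow> 'n \<Rightarrow> 'n set" where
  "below T u = {w \<in> nodes T. (u, w) \<in> (children T)\<^sup>*}"

definition above :: "'n rooted_tree \<Rightarrow> 'n \<Rightarrow> 'n set" where
  "above T u = nodes T - below T u"

(* Connectedness in the underlying undirected tree: any two nodes of S are joined by
   a path that stays inside S. The empty set counts as connected. *)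
definition connected_in :: "'n rooted_tree \<Rightarrow> 'n set \<Rightarrow> bool" where
  "connected_in T S \<longleftrightarrow>
     (\<forall>u\<in>S. \<forall>w\<in>S. (u, w) \<in> ((children T \<union> (children T)\<inverse>) \<inter> S \<times> S)\<^sup>*)"

record ('n, 'v) decomposition =
  dtree :: "'n rooted_tree"
  chi :: "'n \<Rightarrow> 'v set"
  lam :: "'n \<Rightarrow> 'v set set"

definition chi_of :: "('n, 'v) decomposition \<Rightarrow> 'n set \<Rightarrow> 'v set" where
  "chi_of D S = (\<Union>u\<in>S. chi D u)"

definition is_HD ::
  "'v hypergraph \<Rightarrow> 'v ext_subhypergraph \<Rightarrow> ('n, 'v) decomposition \<Rightarrow> bool" where
  "is_HD H H' D \<longleftrightarrow>
     (let T = dtree D; N = nodes T; E' = edges H'; Sp = special H' in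
       is_rooted_tree T \<and>
       (\<forall>u\<in>N. chi D u \<subseteq> hverts H \<and> lam D u \<subseteq> hedges H \<union> Sp) \<and>
       (\<forall>u\<in>N. (lam D u \<subseteq> hedges H \<and> chi D u \<subseteq> \<Union>(lam D u)) \<or>
               (\<exists>s\<in>Sp. lam D u = {s} \<and> chi D u = s)) \<and>
       (\<forall>f\<in>E'. \<exists>u\<in>N. f \<subseteq> chi D u) \<and>
       (\<forall>f\<in>Sp. \<exists>u\<in>N. lam D u = {f} \<and> chi D u = f) \<and>
       (\<forall>v\<in>\<Union>E' \<union> \<Union>Sp. connected_in T {u\<in>N. v \<in> chi D u}) \<and>
       (\<forall>u\<in>N. chi_of D (below T u) \<inter> \<Union>(lam D u) \<subseteq> chi D u) \<and>
       (\<forall>u\<in>N. (\<exists>s\<in>Sp. lam D u = {s}) \<longrightarrow> leaf T u) \<and>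
       conn H' \<subseteq> chi D (root T))"

definition cov ::
  "'v ext_subhypergraph \<Rightarrow> ('n, 'v) decomposition \<Rightarrow> 'n \<Rightarrow> 'v set set" where
  "cov H' D u =
     {f \<in> edges H' \<union> special H'.
        f \<subseteq> chi D u \<and> (\<forall>a. proper_ancestor (dtree D) a u \<longrightarrow> \<not> f \<subseteq> chi D a)}"

definition cov_of ::
  "'v ext_subhypergraph \<Rightarrow> ('n, 'v) decomposition \<Rightarrow> 'n set \<Rightarrow> 'v set set" where
  "cov_of H' D S = (\<Union>u\<in>S. cov H' D u)"

definition balanced_separator ::
  "'v ext_subhypergraph \<Rightarrow> ('n, 'v) decomposition \<Rightarrow> 'n \<Rightarrow> bool" where
  "balanced_separator H' D u \<longleftrightarrow>
     (let T = dtree D; half = (real (card (edges H')) + real (card (special H'))) / 2 in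
       u \<in> nodes T \<and>
       (\<forall>w. (u, w) \<in> children T \<longrightarrow> real (card (cov_of H' D (below T w))) \<le> half) \<and>
       real (card (cov_of H' D (above T u))) < half)"

end

theory Submission
  imports Defs
begin

text \<open>
  Call a node light if fewer than half of the (special) edges are first covered above it. The root
  is light, so there is a lowest light node \<open>u\<close>. If more than half of the edges were
  first covered below a child \<open>w\<close> of \<open>u\<close>, then \<open>w\<close> would be light as well, because no edge is
  first covered both above and below \<open>w\<close>: by connectedness such an edge would be contained in
  the label of \<open>u\<close>, a proper ancestor of everything below \<open>w\<close>.
\<close>

text \<open>Parents are unique, so a cycle through a node also passes through its parent. Going back
  along the path from the root moves the cycle up to the root, which has no parent.\<close>

lemma rooted_tree_acyclic:
  assumes T: "is_rooted_tree T"
  shows "acyclic (children T)"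
proof -
  have no_cycle: "(x, x) \<notin> (children T)\<^sup>+" if "(root T, x) \<in> (children T)\<^sup>*" for x
    using that
  proof (induction rule: rtrancl_induct)
    case base
    show ?case
      using T unfolding is_rooted_tree_def by (blast elim: tranclE)
  next
    case (step x y)
    show ?case
    proof
      assume "(y, y) \<in> (children T)\<^sup>+"
      then obtain x' where "(y, x') \<in> (children T)\<^sup>*" and "(x', y) \<in> children T"
        by (meson tranclD2)
      moreover from this step.hyps(2) T have "x' = x"
        unfolding is_rooted_tree_def by blast
      ultimately have "(x, x) \<in> (children T)\<^sup>+"
        using step.hyps(2) by (meson rtrancl_into_trancl2)
      then show False
        using step.IH by contradiction
    qed
  qed
  show ?thesis
  proof (rule acyclicI, rule allI, rule notI)
    fix x
    assume cycle: "(x, x) \<in> (children T)\<^sup>+"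
    then obtain y where "(x, y) \<in> children T"
      by (meson tranclD)
    then have "(root T, x) \<in> (children T)\<^sup>*"
      using T unfolding is_rooted_tree_def by blast
    then show False
      using cycle no_cycle by blast
  qed
qed

text \<open>The edge from \<open>u\<close> to \<open>w\<close> is the only tree edge joining
  \<open>below T w\<close> to the other nodes, so a path inside \<open>S\<close> from
  \<open>a\<close> to \<open>b\<close> must use it and hence visit \<open>u\<close>.\<close>

lemma connected_in_crosses_parent:
  assumes T: "is_rooted_tree T"
    and conn: "connected_in T S"
    and edge: "(u, w) \<in> children T"
    and a: "a \<in> S" "a \<notin> below T w"
    and b: "b \<in> S" "b \<in> below T w"
  shows "u \<in> S"
proof -
  have "(a, b) \<in> ((children T \<union> (children T)\<inverse>) \<inter> S \<times> S)\<^sup>*"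
    using conn a(1) b(1) unfolding connected_in_def by blast
  \<comment> \<open>As an implication about the current end of the path this is inductive: the only
    critical step is one that enters \<open>below T w\<close> from outside.\<close>
  then have "b \<in> below T w \<longrightarrow> u \<in> S"
  proof (induction rule: rtrancl_induct)
    case base
    then show ?case using a(2) by blast
  next
    case (step x y)
    show ?case
    proof
      assume y: "y \<in> below T w"
      show "u \<in> S"
      proof (cases "x \<in> below T w")
        case True
        then show ?thesis using step.IH by blast
      next
        case False
        have nodes: "x \<in> nodes T"
          using step.hyps(2) T unfolding is_rooted_tree_def by blast
        have "(y, x) \<notin> children T"
          using y nodes False unfolding below_def by (auto intro: rtrancl_into_rtrancl)
        then have xy: "(x, y) \<in> children T"
          using step.hyps(2) by blast
        \<comment> \<open>Any other node below \<open>w\<close> has its unique parent below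
          \<open>w\<close> too, whereas the parent \<open>x\<close> of \<open>y\<close> lies
          outside.\<close>
        have "y = w"
        proof (rule ccontr)
          assume "y \<noteq> w"
          then obtain z where "(w, z) \<in> (children T)\<^sup>*" "(z, y) \<in> children T"
            using y unfolding below_def by (auto elim: rtranclE)
          then have "(w, x) \<in> (children T)\<^sup>*"
            using xy T unfolding is_rooted_tree_def by blast
          then show False
            using False nodes unfolding below_def by blast
        qed
        then have "x = u"
          using xy edge T unfolding is_rooted_tree_def by blast
        then show ?thesis using step.hyps(2) by blast
      qed
    qed
  qed
  then show ?thesis using b(2) by blast
qed

lemma cov_of_subset: "cov_of H' D S \<subseteq> edges H' \<union> special H'"
  unfolding cov_of_def cov_def by blast

lemma cov_of_above_below_disjoint:
  assumes HD: "is_HD H H' D"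
    and edge: "(u, w) \<in> children (dtree D)"
  shows "cov_of H' D (above (dtree D) w) \<inter> cov_of H' D (below (dtree D) w) = {}"
proof -
  let ?T = "dtree D"
  have T: "is_rooted_tree ?T"
    and conn: "\<And>v. v \<in> \<Union>(edges H') \<union> \<Union>(special H') \<Longrightarrow>
      connected_in ?T {u \<in> nodes ?T. v \<in> chi D u}"
    using HD by (simp_all add: is_HD_def Let_def)
  have False
    if a: "a \<in> above ?T w" "f \<in> cov H' D a" and b: "b \<in> below ?T w" "f \<in> cov H' D b" for f a b
  proof -
    have "proper_ancestor ?T u b"
      using edge b(1) unfolding proper_ancestor_def below_def by auto
    then have "\<not> f \<subseteq> chi D u"
      using b(2) unfolding cov_def by blast
    \<comment> \<open>Connectedness is a condition on single vertices, so it is applied to one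
      vertex of \<open>f\<close> missing at \<open>u\<close>.\<close>
    then obtain v where v: "v \<in> f" "v \<notin> chi D u"
      by blast
    let ?S = "{x \<in> nodes ?T. v \<in> chi D x}"
    have "v \<in> \<Union>(edges H') \<union> \<Union>(special H')"
      using v(1) a(2) by (auto simp: cov_def)
    then have "connected_in ?T ?S"
      by (rule conn)
    moreover have "a \<in> ?S" "a \<notin> below ?T w"
      using a v(1) by (auto simp: above_def cov_def)
    moreover have "b \<in> ?S"
      using b v(1) by (auto simp: below_def cov_def)
    ultimately have "u \<in> ?S"
      using connected_in_crosses_parent[OF T _ edge] b(1) by blast
    then show False
      using v(2) by blast
  qed
  then show ?thesis
    unfolding cov_of_def by blast
qed

theorem lemma3p10:
  fixes H :: "'v hypergraph"
    and H' :: "'v ext_subhypergraph"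
    and D :: "('n, 'v) decomposition"
  assumes "is_hypergraph H"
    and "is_ext_subhypergraph H H'"
    and "edges H' \<union> special H' \<noteq> {}"
    and "is_HD H H' D"
  shows "\<exists>u\<in>nodes (dtree D). balanced_separator H' D u"
proof -
  let ?T = "dtree D"
  let ?above = "\<lambda>u. cov_of H' D (above ?T u)" and ?below = "\<lambda>u. cov_of H' D (below ?T u)"
  define half where "half = (real (card (edges H')) + real (card (special H'))) / 2"
  define light where "light = {u \<in> nodes ?T. real (card (?above u)) < half}"
  have T: "is_rooted_tree ?T"
    using assms(4) by (simp add: is_HD_def Let_def)
  have "edges H' \<subseteq> Pow (hverts H)" "special H' \<subseteq> Pow (hverts H)" "finite (hverts H)"
    using assms(1,2) unfolding is_hypergraph_def is_ext_subhypergraph_def by blast+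
  then have fin: "finite (edges H')" "finite (special H')"
    by (auto intro: finite_subset)
  \<comment> \<open>No node lies above the root, so its count is 0; the strict bound in
    \<open>light\<close> then requires at least one edge.\<close>
  then have "half > 0"
    using assms(3) unfolding half_def
    by (cases "edges H' = {}") (simp_all add: card_gt_0_iff add_pos_nonneg)
  moreover have "above ?T (root ?T) = {}"
    using T unfolding above_def below_def is_rooted_tree_def by blast
  ultimately have "root ?T \<in> light"
    using T unfolding light_def is_rooted_tree_def cov_of_def by simp
  \<comment> \<open>In the converse relation a child is smaller than its parent, so a minimal
    element of \<open>light\<close> is a light node without light children.\<close>
  moreover have "wf ((children ?T)\<inverse>)"
  proof (rule finite_acyclic_wf_converse)
    show "finite (children ?T)"
      using T unfolding is_rooted_tree_def by (auto intro: finite_subset)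
    show "acyclic (children ?T)"
      using T by (rule rooted_tree_acyclic)
  qed
  ultimately obtain u where u: "u \<in> light"
    and lowest: "\<And>w. (w, u) \<in> (children ?T)\<inverse> \<Longrightarrow> w \<notin> light"
    by (metis wfE_min)
  have "real (card (?below w)) \<le> half" if w: "(u, w) \<in> children ?T" for w
  proof (rule ccontr)
    assume heavy: "\<not> real (card (?below w)) \<le> half"
    have "finite (?above w)" "finite (?below w)"
      using fin by (auto intro: finite_subset[OF cov_of_subset])
    then have "card (?above w) + card (?below w) = card (?above w \<union> ?below w)"
      using cov_of_above_below_disjoint[OF assms(4) w] by (simp add: card_Un_disjoint)
    also have "\<dots> \<le> card (edges H' \<union> special H')"
      using fin by (intro card_mono Un_least cov_of_subset) auto
    \<comment> \<open>A set may be both an edge and a special edge, so \<open>2 * half\<close> is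
      only an upper bound for the number of distinct ones.\<close>
    also have "\<dots> \<le> card (edges H') + card (special H')"
      by (rule card_Un_le)
    finally have "real (card (?above w)) + real (card (?below w)) \<le> 2 * half"
      unfolding half_def by (simp flip: of_nat_add)
    \<comment> \<open>The part below \<open>w\<close> strictly exceeds \<open>half\<close>, which
      yields the strict inequality demanded by \<open>light\<close>.\<close>
    then have "real (card (?above w)) < half"
      using heavy by linarith
    then have "w \<in> light"
      using w T unfolding light_def is_rooted_tree_def by blast
    then show False
      using lowest w by blast
  qed
  then show ?thesis
    using u unfolding balanced_separator_def Let_def light_def half_def by blast
qed

end
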